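(* There exists a family of Type II self-dual codes $C_i$ over $\mathbb{Z}_4$, with lengths $n_i\to\infty$, such that $\liminf_{i\to\infty} l_i/(2n_i)\ge\delta$, where $l_i$ is the minimal Lee weight of a nonzero codeword of $C_i$ and $\delta\in(0,1/2)$ is the solution of $-\delta\log_2\delta-(1-\delta)\log_2(1-\delta)=\tfrac12$.
   Context: A code over $\mathbb{Z}_4$ is a submodule of $\mathbb{Z}_4^n$, with inner product $\sum x_iy_i \bmod 4$; self-dual means $C=C^\perp$. $\mathrm{Lee}(0)=0,\mathrm{Lee}(1)=\mathrm{Lee}(3)=1,\mathrm{Lee}(2)=2$; the Lee weight of a vector is the sum over coordinates, and its Euclidean norm is $\sum\mathrm{Lee}(u_i)^2$. A self-dual code over $\mathbb{Z}_4$ is Type II if all Euclidean norms of codewords are divisible by 8. *)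

theory Defs
  imports
    "Jordan_Normal_Form.VS_Connect"
    "HOL-Library.Numeral_Type"
    "HOL-Library.Extended_Real"
begin

text \<open>
  The numeral type \<open>4\<close> with its ring operations is the ring of integers modulo 4, so its elements
  are \<open>0, 1, 2, 3\<close> (and the literal \<open>4 :: 4\<close> equals \<open>0\<close>); \<open>carrier_vec n\<close> at this type is
  the module of all vectors of length \<open>n\<close> over it, and \<open>\<bullet>\<close> is the inner product modulo 4.
\<close>

type_synonym z4 = 4

definition z4_code :: "nat \<Rightarrow> z4 vec set \<Rightarrow> bool" where
  "z4_code n C \<longleftrightarrow> Module.submodule C (class_ring :: z4 ring) (module_vec TYPE(z4) n)"

definition dual_code :: "nat \<Rightarrow> z4 vec set \<Rightarrow> z4 vec set" where
  "dual_code n C = {x \<in> carrier_vec n. \<forall>y \<in> C. x \<bullet> y = 0}"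

definition self_dual_code :: "nat \<Rightarrow> z4 vec set \<Rightarrow> bool" where
  "self_dual_code n C \<longleftrightarrow> z4_code n C \<and> C = dual_code n C"

definition Lee :: "z4 \<Rightarrow> nat" where
  "Lee x = (if x = 0 then 0 else if x = 2 then 2 else 1)"

definition lee_weight :: "z4 vec \<Rightarrow> nat" where
  "lee_weight u = (\<Sum>i < dim_vec u. Lee (u $ i))"

definition euclidean_norm :: "z4 vec \<Rightarrow> nat" where
  "euclidean_norm u = (\<Sum>i < dim_vec u. (Lee (u $ i))\<^sup>2)"

definition type_II_code :: "nat \<Rightarrow> z4 vec set \<Rightarrow> bool" where
  "type_II_code n C \<longleftrightarrow> self_dual_code n C \<and> (\<forall>u \<in> C. 8 dvd euclidean_norm u)"

text \<open>
  The set below is finite, and for a self-dual code of length \<open>n > 0\<close> it is nonempty.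
\<close>

definition min_lee_weight :: "nat \<Rightarrow> z4 vec set \<Rightarrow> nat" where
  "min_lee_weight n C = Min (lee_weight ` (C - {0\<^sub>v n}))"

end

theory Submission
  imports Defs
begin

text \<open>
  Let \<open>n\<close> be a multiple of 8 and \<open>m = n / 2 - 1\<close>. The orthogonal complement of the all-ones vector
  \<open>\<one>\<close> in \<open>\<int>\<^sub>4\<^sup>n\<close>, taken modulo \<open>\<one>\<close> and with the quadratic form \<open>v \<bullet> v / 2\<close>, is hyperbolic: it has
  a basis \<open>e\<^sub>i\<close>, \<open>f\<^sub>i\<close> (\<open>i < m\<close>) with \<open>e\<^sub>i \<bullet> f\<^sub>j = \<delta>\<^sub>i\<^sub>j\<close> and all other products zero. Hence every
  alternating \<open>m \<times> m\<close> matrix \<open>A\<close> over \<open>\<int>\<^sub>4\<close> yields a Type II code \<open>C\<^sub>A\<close>, spanned by \<open>\<one>\<close> and the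
  \<open>e\<^sub>i + \<Sum>\<^sub>j A\<^sub>i\<^sub>j f\<^sub>j\<close>, and \<open>v \<in> C\<^sub>A\<close> iff \<open>v \<bullet> \<one> = 0\<close> and \<open>y = - A x\<close> for
  \<open>x = (v \<bullet> f\<^sub>i)\<^sub>i\<close>, \<open>y = (v \<bullet> e\<^sub>i)\<^sub>i\<close>.

  If some \<open>x\<^sub>p\<close> is a unit, the equation \<open>y = - A x\<close> determines row \<open>p\<close> of \<open>A\<close> from the other entries, so at
  most a fraction \<open>4\<^bsup>-(m-1)\<^esup>\<close> of all \<open>A\<close> satisfies it; if all \<open>x\<^sub>i\<close> are even but not all are zero, the
  fraction is at most \<open>2\<^bsup>-(m-1)\<^esup>\<close>, and then a vector of Lee weight less than \<open>n\<close> has all its entries in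
  \<open>{0, 2}\<close>. By Chernoff's bound with parameter \<open>r = \<delta> / (1 - \<delta>)\<close> there are at most \<open>B\<^bsup>2n\<^esup>\<close>
  vectors, and \<open>B\<^sup>n\<close> vectors over \<open>{0, 2}\<close>, of Lee weight below \<open>2 n \<lambda>\<close>, where
  \<open>B = (1 + r) r\<^bsup>-\<lambda>\<^esup>\<close>. The equation for \<open>\<delta>\<close> says that \<open>B = \<surd>2\<close> for \<open>\<lambda> = \<delta>\<close>, so for
  \<open>\<lambda> < \<delta>\<close> and large \<open>n\<close> the union bound leaves a matrix \<open>A\<close> whose code has no light words.
\<close>

section \<open>Integer inner products and concatenation\<close>

definition int_inner :: "nat \<Rightarrow> (nat \<Rightarrow> int) \<Rightarrow> (nat \<Rightarrow> int) \<Rightarrow> int" where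
  "int_inner n v w = (\<Sum>k<n. v k * w k)"

lemma int_inner_commute: "int_inner n v w = int_inner n w v"
  by (simp add: int_inner_def mult.commute)

lemma int_inner_add_right:
  "int_inner n v (\<lambda>k. w k + z k) = int_inner n v w + int_inner n v z"
  by (simp add: int_inner_def algebra_simps sum.distrib)

lemma int_inner_add_left:
  "int_inner n (\<lambda>k. w k + z k) v = int_inner n w v + int_inner n z v"
  by (simp add: int_inner_def algebra_simps sum.distrib)

lemma int_inner_diff_right:
  "int_inner n v (\<lambda>k. w k - z k) = int_inner n v w - int_inner n v z"
  by (simp add: int_inner_def algebra_simps sum_subtractf)

lemma int_inner_diff_left:
  "int_inner n (\<lambda>k. w k - z k) v = int_inner n w v - int_inner n z v"
  by (simp add: int_inner_def algebra_simps sum_subtractf)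

lemma int_inner_sum_right:
  "int_inner n v (\<lambda>k. \<Sum>j\<in>J. c j * w j k) = (\<Sum>j\<in>J. c j * int_inner n v (w j))"
  unfolding int_inner_def sum_distrib_left by (subst sum.swap) (simp add: mult.left_commute)

lemma int_inner_zero [simp]: "int_inner n v (\<lambda>_. 0) = 0" "int_inner n (\<lambda>_. 0) v = 0"
  by (simp_all add: int_inner_def)

lemma int_inner_one_one [simp]: "int_inner n (\<lambda>_. 1) (\<lambda>_. 1) = int n"
  by (simp add: int_inner_def)

definition append_fun :: "nat \<Rightarrow> (nat \<Rightarrow> int) \<Rightarrow> (nat \<Rightarrow> int) \<Rightarrow> nat \<Rightarrow> int" where
  "append_fun n v w k = (if k < n then v k else w (k - n))"

lemma int_inner_append [simp]:
  "int_inner (n + n') (append_fun n v w) (append_fun n v' w') = int_inner n v v' + int_inner n' w w'"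
proof -
  have "(\<Sum>k = n..<n + n'. w (k - n) * w' (k - n)) = (\<Sum>k<n'. w k * w' k)"
    using sum.shift_bounds_nat_ivl[of "\<lambda>k. w (k - n) * w' (k - n)" 0 n n']
    by (simp add: lessThan_atLeast0 add.commute)
  moreover have "{..<n + n'} = {..<n} \<union> {n..<n + n'}" by auto
  ultimately show ?thesis
    by (simp add: int_inner_def append_fun_def sum.union_disjoint ivl_disj_int(2) disjoint_iff)
qed

lemma append_fun_const: "append_fun n (\<lambda>_. c) (\<lambda>_. c) = (\<lambda>_. c)"
  by (simp add: append_fun_def fun_eq_iff)

lemma append_fun_split: "append_fun n v (\<lambda>k. v (n + k)) = v"
  by (simp add: append_fun_def fun_eq_iff)

section \<open>Hyperbolic frames for all lengths divisible by 8\<close>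

text \<open>
  The vectors \<open>e i\<close>, \<open>f i\<close> form a hyperbolic basis of the complement of the all-ones vector modulo
  itself, and \<open>u\<close> and the all-ones vector complete them to a basis modulo 4. The last assumption
  expresses the norm modulo 8 by the coordinates in this basis.
\<close>

locale hyperbolic_frame =
  fixes n m :: nat and e f :: "nat \<Rightarrow> nat \<Rightarrow> int" and u :: "nat \<Rightarrow> int"
  assumes size: "n = 2 * m + 2"
    and four_dvd_size: "4 dvd int n"
    and e_e: "\<And>i j. i < m \<Longrightarrow> j < m \<Longrightarrow> 4 dvd int_inner n (e i) (e j)"
    and f_f: "\<And>i j. i < m \<Longrightarrow> j < m \<Longrightarrow> 4 dvd int_inner n (f i) (f j)"
    and e_f: "\<And>i j. i < m \<Longrightarrow> j < m \<Longrightarrow>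
      4 dvd int_inner n (e i) (f j) - (if i = j then 1 else 0)"
    and one_e: "\<And>i. i < m \<Longrightarrow> 4 dvd int_inner n (\<lambda>_. 1) (e i)"
    and one_f: "\<And>i. i < m \<Longrightarrow> 4 dvd int_inner n (\<lambda>_. 1) (f i)"
    and u_e: "\<And>i. i < m \<Longrightarrow> 4 dvd int_inner n u (e i)"
    and u_f: "\<And>i. i < m \<Longrightarrow> 4 dvd int_inner n u (f i)"
    and one_u: "4 dvd int_inner n (\<lambda>_. 1) u - 1"
    and u_u: "4 dvd int_inner n u u - 1"
    and norm: "\<And>v. 8 dvd int_inner n v v
      - (2 * (\<Sum>i<m. int_inner n v (e i) * int_inner n v (f i))
         + 2 * int_inner n v (\<lambda>_. 1) * int_inner n v u - (int_inner n v (\<lambda>_. 1))\<^sup>2)"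

text \<open>
  The extra hyperbolic plane is spanned by the all-ones vector of the first block and by
  \<open>u - (u' - \<one>')\<close>, which is isotropic since \<open>u' - \<one>'\<close> has norm \<open>-1\<close>.
\<close>

lemma hyperbolic_frame_append:
  assumes "hyperbolic_frame n m e f u" and "hyperbolic_frame n' m' e' f' u'"
  shows "\<exists>e f u. hyperbolic_frame (n + n') (m + m' + 1) e f u"
proof -
  interpret F: hyperbolic_frame n m e f u by fact
  interpret G: hyperbolic_frame n' m' e' f' u' by fact
  define E where "E i = (if i < m then append_fun n (e i) (\<lambda>_. 0)
    else if i < m + m' then append_fun n (\<lambda>_. 0) (e' (i - m))
    else append_fun n (\<lambda>_. 1) (\<lambda>_. 0))" for i
  define H where "H i = (if i < m then append_fun n (f i) (\<lambda>_. 0)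
    else if i < m + m' then append_fun n (\<lambda>_. 0) (f' (i - m))
    else append_fun n u (\<lambda>k. 1 - u' k))" for i
  \<comment> \<open>Supported on the second block only, \<open>U\<close> is orthogonal to the new
    plane: its product with the last \<open>H\<close> is that of \<open>u'\<close> with
    \<open>1 - u'\<close>, zero mod 4 because \<open>u'\<close> has product 1 both with the all-ones
    vector and with itself.\<close>
  define U where "U = append_fun n (\<lambda>_. 0) u'"
  have one: "int_inner (n + n') (\<lambda>_. 1) (append_fun n v w)
      = int_inner n (\<lambda>_. 1) v + int_inner n' (\<lambda>_. 1) w" for v w
    using int_inner_append[of n n' "\<lambda>_. 1" "\<lambda>_. 1" v w] by (simp add: append_fun_const)
  have sym1: "int_inner k v (\<lambda>_. 1) = int_inner k (\<lambda>_. 1) v" for k v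
    by (rule int_inner_commute)
  have sym: "int_inner n u (\<lambda>_. 1) = int_inner n (\<lambda>_. 1) u"
    "int_inner n' u' (\<lambda>_. 1) = int_inner n' (\<lambda>_. 1) u'"
    "int_inner n (e i) (\<lambda>_. 1) = int_inner n (\<lambda>_. 1) (e i)"
    "int_inner n (f i) (\<lambda>_. 1) = int_inner n (\<lambda>_. 1) (f i)"
    "int_inner n' (e' i) (\<lambda>_. 1) = int_inner n' (\<lambda>_. 1) (e' i)"
    "int_inner n' (f' i) (\<lambda>_. 1) = int_inner n' (\<lambda>_. 1) (f' i)"
    "int_inner n (e i) u = int_inner n u (e i)"
    "int_inner n (f i) u = int_inner n u (f i)" "int_inner n' (e' i) u' = int_inner n' u' (e' i)"
    "int_inner n' (f' i) u' = int_inner n' u' (f' i)" for i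
    by (rule int_inner_commute)+
  have e_f: "4 dvd int_inner n (e i) (f i) - 1" if "i < m" for i
    using F.e_f[of i i] that by simp
  have e_f': "4 dvd int_inner n' (e' i) (f' i) - 1" if "i < m'" for i
    using G.e_f[of i i] that by simp
  have e_f_ne: "4 dvd int_inner n (e i) (f j)" if "i < m" "j < m" "i \<noteq> j" for i j
    using F.e_f[of i j] that by simp
  have e_f_ne': "4 dvd int_inner n' (e' i) (f' j)" if "i < m'" "j < m'" "i \<noteq> j" for i j
    using G.e_f[of i j] that by simp
  note facts = F.four_dvd_size G.four_dvd_size F.e_e G.e_e F.f_f G.f_f F.one_e G.one_e
    F.one_f G.one_f F.u_e G.u_e F.u_f G.u_f F.one_u G.one_u F.u_u G.u_u
  note simps = E_def H_def U_def one int_inner_diff_left int_inner_diff_right sym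
  have "hyperbolic_frame (n + n') (m + m' + 1) E H U"
  proof
    show "n + n' = 2 * (m + m' + 1) + 2" using F.size G.size by simp
    show "4 dvd int (n + n')" using F.four_dvd_size G.four_dvd_size by simp
    show "4 dvd int_inner (n + n') (E i) (E j)" if "i < m + m' + 1" "j < m + m' + 1" for i j
      using that facts by (auto simp: simps)
    show "4 dvd int_inner (n + n') (\<lambda>_. 1) (E i)" if "i < m + m' + 1" for i
      using that facts by (auto simp: simps)
    show "4 dvd int_inner (n + n') U (E i)" if "i < m + m' + 1" for i
      using that facts by (auto simp: simps)
    show "4 dvd int_inner (n + n') (\<lambda>_. 1) U - 1" "4 dvd int_inner (n + n') U U - 1"
      using facts by (auto simp: simps)
    have one_last: "4 dvd int_inner n (\<lambda>_. 1) u + (int n' - int_inner n' (\<lambda>_. 1) u')"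
      using F.one_u G.one_u G.four_dvd_size by presburger
    have u_last: "4 dvd int_inner n' (\<lambda>_. 1) u' - int_inner n' u' u'"
      using G.one_u G.u_u by presburger
    have last_last: "4 dvd int_inner n u u
      + (int n' - int_inner n' (\<lambda>_. 1) u' - (int_inner n' (\<lambda>_. 1) u' - int_inner n' u' u'))"
      using F.u_u G.one_u G.u_u G.four_dvd_size by presburger
    show "4 dvd int_inner (n + n') (H i) (H j)" if "i < m + m' + 1" "j < m + m' + 1" for i j
      using that facts last_last by (auto simp: simps)
    show "4 dvd int_inner (n + n') (\<lambda>_. 1) (H i)" if "i < m + m' + 1" for i
      using that facts one_last by (auto simp: simps)
    show "4 dvd int_inner (n + n') U (H i)" if "i < m + m' + 1" for i
      using that facts u_last by (auto simp: simps)
    show "4 dvd int_inner (n + n') (E i) (H j) - (if i = j then 1 else 0)"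
      if "i < m + m' + 1" "j < m + m' + 1" for i j
      using that e_f e_f' e_f_ne e_f_ne' facts by (auto simp: simps)
    fix v :: "nat \<Rightarrow> int"
    define w where "w k = v (n + k)" for k
    have v: "v = append_fun n v w" unfolding w_def by (simp add: append_fun_split)
    let ?a = "int_inner n (\<lambda>_. 1) v" and ?a' = "int_inner n' (\<lambda>_. 1) w"
      and ?b = "int_inner n v u" and ?b' = "int_inner n' w u'"
    have split: "{..<m + m' + 1} = {..<m} \<union> {m..<m + m'} \<union> {m + m'}" by auto
    have "(\<Sum>i = m..<m + m'. int_inner n' w (e' (i - m)) * int_inner n' w (f' (i - m)))
      = (\<Sum>i<m'. int_inner n' w (e' i) * int_inner n' w (f' i))"
      using sum.shift_bounds_nat_ivl
        [of "\<lambda>i. int_inner n' w (e' (i - m)) * int_inner n' w (f' (i - m))" 0 m m']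
      by (simp add: lessThan_atLeast0 add.commute)
    moreover have "int_inner (n + n') v (E i) * int_inner (n + n') v (H i)
        = int_inner n v (e i) * int_inner n v (f i)" if "i < m" for i
      using that by (subst v, subst (2) v) (simp add: E_def H_def)
    moreover have "int_inner (n + n') v (E i) * int_inner (n + n') v (H i)
        = int_inner n' w (e' (i - m)) * int_inner n' w (f' (i - m))" if "m \<le> i" "i < m + m'" for i
      using that by (subst v, subst (2) v) (simp add: E_def H_def)
    moreover have "int_inner (n + n') v (E (m + m')) * int_inner (n + n') v (H (m + m'))
        = ?a * (?b + (?a' - ?b'))"
      by (subst v, subst (2) v) (simp add: E_def H_def int_inner_diff_right sym1)
    ultimately have s: "(\<Sum>i<m + m' + 1. int_inner (n + n') v (E i) * int_inner (n + n') v (H i))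
      = (\<Sum>i<m. int_inner n v (e i) * int_inner n v (f i))
        + (\<Sum>i<m'. int_inner n' w (e' i) * int_inner n' w (f' i)) + ?a * (?b + (?a' - ?b'))"
      unfolding split by (subst sum.union_disjoint, simp, simp, force)+ simp
    have t: "int_inner (n + n') v v = int_inner n v v + int_inner n' w w"
      by (subst v, subst (2) v) simp
    have a: "int_inner (n + n') v (\<lambda>_. 1) = ?a + ?a'"
      unfolding sym1 by (subst v) (rule one)
    have b: "int_inner (n + n') v U = ?b'"
      by (subst v) (simp add: U_def)
    \<comment> \<open>The new frame's norm expression is exactly the sum of the two old ones: the
      terms \<open>?a * ?a'\<close> and \<open>?a * ?b'\<close> from the extra plane cancel against
      those from \<open>2 * (?a + ?a') * ?b' - (?a + ?a')\<^sup>2\<close>.\<close>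
    have "8 dvd (int_inner n v v
      - (2 * (\<Sum>i<m. int_inner n v (e i) * int_inner n v (f i)) + 2 * ?a * ?b - ?a\<^sup>2))
      + (int_inner n' w w
      - (2 * (\<Sum>i<m'. int_inner n' w (e' i) * int_inner n' w (f' i)) + 2 * ?a' * ?b' - ?a'\<^sup>2))"
      using F.norm[of v] G.norm[of w] unfolding sym1 by (rule dvd_add)
    then show "8 dvd int_inner (n + n') v v
      - (2 * (\<Sum>i<m + m' + 1. int_inner (n + n') v (E i) * int_inner (n + n') v (H i))
         + 2 * int_inner (n + n') v (\<lambda>_. 1) * int_inner (n + n') v U
         - (int_inner (n + n') v (\<lambda>_. 1))\<^sup>2)"
      unfolding s t a b by (simp add: algebra_simps power2_eq_square)
  qed
  then show ?thesis by blast
qed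

text \<open>This is the \<open>norm\<close> condition of the frame below, with the entries of
  \<open>v\<close> as variables. All coefficients of the quadratic form are multiples of 8; the
  witness is the form divided by 8.\<close>

lemma hyperbolic_frame_8_norm:
  fixes a0 a1 a2 a3 a4 a5 a6 a7 :: int
  shows "8 dvd a0*a0 + a1*a1 + a2*a2 + a3*a3 + a4*a4 + a5*a5 + a6*a6 + a7*a7
    - (2 * ((a3 + a4 + a5 - a6 + 2*a7) * (a3 + a4 - a5 + 2*a6 + a7) +
         (a2 + a4 + 2*a5 + a6 - a7) * (a2 + a3 + 2*a4 + a6 - a7) +
         (- a1 + 2*a4 + a5 + a6 + a7) * (2*a0 + a1 + a2 + a3 - a4))
       + 2 * (a0 + a1 + a2 + a3 + a4 + a5 + a6 + a7) * (a0 + 2*a1 + 2*a5 + 2*a6 + 2*a7)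
       - (a0 + a1 + a2 + a3 + a4 + a5 + a6 + a7)\<^sup>2)"
  by (rule dvdI[of _ _ "- a0*a4 - a0*a5 - a0*a6 - a0*a7 - a1*a4 - a1*a5 - a1*a6 - a1*a7 - a2*a4 - a2*a5
      - a2*a6 - a3*a4 - a3*a5 - a3*a6 - a3*a7 - a4*a5 - a4*a6 - 2*a5*a6 - a6*a7 - a7*a7"])
    (simp add: algebra_simps power2_eq_square)

text \<open>The frame of length 8 was found by a computer search.\<close>

lemma hyperbolic_frame_8: "\<exists>e f u. hyperbolic_frame 8 3 e f u"
proof -
  define e :: "nat \<Rightarrow> nat \<Rightarrow> int" where
    "e i k = [[0, 0, 0, 1, 1, 1, -1, 2], [0, 0, 1, 0, 1, 2, 1, -1],
      [0, -1, 0, 0, 2, 1, 1, 1]] ! i ! k" for i k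
  define f :: "nat \<Rightarrow> nat \<Rightarrow> int" where
    "f i k = [[0, 0, 0, 1, 1, -1, 2, 1], [0, 0, 1, 1, 2, 0, 1, -1],
      [2, 1, 1, 1, -1, 0, 0, 0]] ! i ! k" for i k
  define u :: "nat \<Rightarrow> int" where "u k = [1, 2, 0, 0, 0, 2, 2, 2] ! k" for k
  have inner: "int_inner 8 v w = v 0 * w 0 + v 1 * w 1 + v 2 * w 2 + v 3 * w 3
      + v 4 * w 4 + v 5 * w 5 + v 6 * w 6 + v 7 * w 7" for v w
    by (simp add: int_inner_def eval_nat_numeral)
  have three: "i < 3 \<longleftrightarrow> i = 0 \<or> i = 1 \<or> i = 2" for i :: nat by auto
  note simps = inner e_def f_def u_def
  have "hyperbolic_frame 8 3 e f u"
  proof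
    fix v :: "nat \<Rightarrow> int"
    have sum3: "(\<Sum>i<3. g i) = g 0 + g 1 + g 2" for g :: "nat \<Rightarrow> int"
      by (simp add: eval_nat_numeral)
    show "8 dvd int_inner 8 v v
      - (2 * (\<Sum>i<3. int_inner 8 v (e i) * int_inner 8 v (f i))
         + 2 * int_inner 8 v (\<lambda>_. 1) * int_inner 8 v u - (int_inner 8 v (\<lambda>_. 1))\<^sup>2)"
      using hyperbolic_frame_8_norm[of "v 0" "v 1" "v 2" "v 3" "v 4" "v 5" "v 6" "v 7"]
      unfolding sum3 by (simp add: simps mult.commute)
  qed (auto simp: three simps)
  then show ?thesis by blast
qed

lemma hyperbolic_frame_exists: "\<exists>e f u. hyperbolic_frame (8 * (k + 1)) (4 * k + 3) e f u"
proof (induction k)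
  case 0
  then show ?case using hyperbolic_frame_8 by simp
next
  case (Suc k)
  then obtain e f u where "hyperbolic_frame (8 * (k + 1)) (4 * k + 3) e f u" by blast
  moreover obtain e' f' u' where "hyperbolic_frame 8 3 e' f' u'" using hyperbolic_frame_8 by blast
  ultimately show ?case using hyperbolic_frame_append by (fastforce simp: algebra_simps)
qed

section \<open>Alternating matrices and the number of solutions of a linear system\<close>

text \<open>
  An alternating matrix is given by one entry for each two-element set of indices.
\<close>

definition pairs :: "nat \<Rightarrow> nat set set" where
  "pairs m = (\<lambda>(i, j). {i, j}) ` {(i, j). i < m \<and> j < m \<and> i \<noteq> j}"

definition alt_params :: "nat \<Rightarrow> (nat set \<Rightarrow> int) set" where
  "alt_params m = (\<Pi>\<^sub>E s\<in>pairs m. {0..3})"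

text \<open>The factor \<open>sgn\<close> supplies both the antisymmetry and the zero diagonal, so
  the value of \<open>a\<close> at a singleton never matters.\<close>

definition alt_entry :: "(nat set \<Rightarrow> int) \<Rightarrow> nat \<Rightarrow> nat \<Rightarrow> int" where
  "alt_entry a i j = sgn (int j - int i) * a {i, j}"

lemma alt_entry_antisym: "alt_entry a j i = - alt_entry a i j"
proof -
  have "sgn (int i - int j) = - sgn (int j - int i)"
    by (simp add: sgn_if)
  then show ?thesis by (simp add: alt_entry_def insert_commute)
qed

text \<open>Exchanging the indices negates the sum. Over the integers this forces it to vanish,
  whereas modulo 4 it would only kill its double.\<close>

lemma alt_entry_quadratic: "(\<Sum>i<m. \<Sum>j<m. x i * (alt_entry a i j * x j)) = 0"
proof -
  have "(\<Sum>i<m. \<Sum>j<m. x i * (alt_entry a i j * x j)) = (\<Sum>i<m. \<Sum>j<m. x j * (alt_entry a j i * x i))"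
    by (rule sum.swap)
  also have "\<dots> = - (\<Sum>i<m. \<Sum>j<m. x i * (alt_entry a i j * x j))"
    by (subst alt_entry_antisym) (simp add: sum_negf mult_ac)
  finally show ?thesis by simp
qed

lemma finite_pairs: "finite (pairs m)"
proof -
  have "{(i, j). i < m \<and> j < m \<and> i \<noteq> j} \<subseteq> {..<m} \<times> {..<m}" by auto
  then show ?thesis unfolding pairs_def by (meson finite_SigmaI finite_imageI finite_lessThan finite_subset)
qed

lemma finite_alt_params: "finite (alt_params m)"
  by (simp add: alt_params_def finite_pairs finite_PiE)

lemma alt_params_nonempty: "alt_params m \<noteq> {}"
  by (simp add: alt_params_def PiE_eq_empty_iff)

text \<open>A function is determined by its restrictions to \<open>I - L\<close> and
  \<open>L\<close>. Once the first is fixed, each value on \<open>L\<close> is confined to a set of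
  at most \<open>g\<close> elements.\<close>

lemma card_PiE_constrained_le:
  assumes "finite I" "L \<subseteq> I" "finite D"
    and S: "S \<subseteq> (\<Pi>\<^sub>E i\<in>I. D)"
    and T: "\<And>h l. finite (T h l)" "\<And>h l. card (T h l) \<le> g"
    and mem: "\<And>a l. a \<in> S \<Longrightarrow> l \<in> L \<Longrightarrow> a l \<in> T (restrict a (I - L)) l"
  shows "card S \<le> card D ^ card (I - L) * g ^ card L"
proof -
  let ?B = "SIGMA h : (\<Pi>\<^sub>E i\<in>I - L. D). \<Pi>\<^sub>E l\<in>L. T h l"
  have fin: "finite (\<Pi>\<^sub>E i\<in>I - L. D)" "finite L"
    using assms by (auto intro: finite_PiE finite_subset)
  have "inj_on (\<lambda>a. (restrict a (I - L), restrict a L)) S"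
  proof (rule inj_onI)
    fix a b assume ab: "a \<in> S" "b \<in> S"
      and eq: "(restrict a (I - L), restrict a L) = (restrict b (I - L), restrict b L)"
    show "a = b"
    proof (rule PiE_ext)
      show "a \<in> (\<Pi>\<^sub>E i\<in>I. D)" "b \<in> (\<Pi>\<^sub>E i\<in>I. D)" using ab S by auto
      fix i assume "i \<in> I"
      moreover have "restrict a (I - L) i = restrict b (I - L) i" "restrict a L i = restrict b L i"
        using eq by simp_all
      ultimately show "a i = b i" by (cases "i \<in> L") simp_all
    qed
  qed
  moreover have "(\<lambda>a. (restrict a (I - L), restrict a L)) ` S \<subseteq> ?B"
  proof (rule image_subsetI)
    fix a assume a: "a \<in> S"
    then have "a \<in> (\<Pi>\<^sub>E i\<in>I. D)" using S by auto
    then have "restrict a (I - L) \<in> (\<Pi>\<^sub>E i\<in>I - L. D)" by auto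
    moreover have "restrict a L \<in> Pi\<^sub>E L (T (restrict a (I - L)))"
      using mem[OF a] by auto
    ultimately show "(restrict a (I - L), restrict a L) \<in> ?B" by simp
  qed
  moreover have "finite ?B" using fin T(1) by (intro finite_SigmaI[OF fin(1)] finite_PiE) auto
  ultimately have "card S \<le> card ?B" by (rule card_inj_on_le)
  also have "\<dots> = (\<Sum>h\<in>(\<Pi>\<^sub>E i\<in>I - L. D). \<Prod>l\<in>L. card (T h l))"
    using fin T(1) by (simp add: card_SigmaI finite_PiE card_PiE)
  also have "\<dots> \<le> (\<Sum>h\<in>(\<Pi>\<^sub>E i\<in>I - L. D). g ^ card L)"
  proof (rule sum_mono)
    fix h
    show "(\<Prod>l\<in>L. card (T h l)) \<le> g ^ card L"
      using prod_mono[of L "\<lambda>l. card (T h l)" "\<lambda>_. g"] T(2) by simp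
  qed
  also have "\<dots> = card D ^ card (I - L) * g ^ card L"
    using assms(1) by (simp add: card_PiE)
  finally show ?thesis .
qed

text \<open>Fix all parameters except the \<open>m - 1\<close> pairs containing \<open>p\<close>.
  For each \<open>q\<close> other than \<open>p\<close>, equation \<open>q\<close> then has the
  single unknown \<open>a {p, q}\<close>, with coefficient \<open>x p\<close> up to sign. Equation
  \<open>p\<close> itself is ignored.\<close>

lemma card_alt_solutions_le:
  fixes x y :: "nat \<Rightarrow> int"
  assumes p: "p < m" and g: "\<And>r. card {t \<in> {0..3}. 4 dvd t * x p + r} \<le> g"
  shows "card {a \<in> alt_params m. \<forall>i<m. 4 dvd y i + (\<Sum>j<m. alt_entry a i j * x j)} * 4 ^ (m - 1)
    \<le> card (alt_params m) * g ^ (m - 1)"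
proof -
  define L where "L = (\<lambda>q. {p, q}) ` ({..<m} - {p})"
  define S where "S = {a \<in> alt_params m. \<forall>i<m. 4 dvd y i + (\<Sum>j<m. alt_entry a i j * x j)}"
  \<comment> \<open>\<open>the_elem (l - {p})\<close> recovers \<open>q\<close> from
    \<open>l = {p, q}\<close>. Multiplying equation \<open>q\<close> by the sign makes the
    coefficient of the unknown exactly \<open>x p\<close>.\<close>
  define T where "T h l = (let q = the_elem (l - {p}) in {t \<in> {0..3}. 4 dvd t * x p +
    sgn (int p - int q) * (y q + (\<Sum>j\<in>{..<m} - {p}. alt_entry h q j * x j))})" for h l
  have "inj_on (\<lambda>q. {p, q}) ({..<m} - {p})"
    by (auto simp: inj_on_def doubleton_eq_iff)
  then have card_L: "card L = m - 1" unfolding L_def using p by (simp add: card_image)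
  have L_sub: "L \<subseteq> pairs m" using p by (auto simp: L_def pairs_def)
  have "card S \<le> card {0..3::int} ^ card (pairs m - L) * g ^ card L"
  proof (rule card_PiE_constrained_le[where T = T])
    show "S \<subseteq> (\<Pi>\<^sub>E i\<in>pairs m. {0..3})" by (auto simp: S_def alt_params_def)
    show "finite (T h l)" for h l unfolding T_def Let_def by (rule finite_Collect_conjI) simp
    show "card (T h l) \<le> g" for h l unfolding T_def Let_def by (rule g)
    fix a l assume a: "a \<in> S" and "l \<in> L"
    then obtain q where q: "q < m" "q \<noteq> p" and l: "l = {p, q}" by (auto simp: L_def)
    have the: "the_elem (l - {p}) = q" using q l by (simp add: insert_Diff_if)
    let ?s = "sgn (int p - int q)"
    have s: "?s * ?s = 1" using q(2) by (auto simp: sgn_if)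
    have al: "a l \<in> {0..3}" using a \<open>l \<in> L\<close> L_sub by (auto simp: S_def alt_params_def)
    \<comment> \<open>Off column \<open>p\<close>, row \<open>q\<close> uses only pairs outside
      \<open>L\<close>, apart from its diagonal entry, which is zero for any parameters.\<close>
    have restr: "alt_entry (restrict a (pairs m - L)) q j = alt_entry a q j" if "j < m" "j \<noteq> p" for j
    proof (cases "j = q")
      case True
      then show ?thesis by (simp add: alt_entry_def)
    next
      case False
      then have "{q, j} \<in> pairs m - L" using that q by (auto simp: L_def pairs_def doubleton_eq_iff)
      then show ?thesis by (simp add: alt_entry_def)
    qed
    have "4 dvd ?s * (y q + (\<Sum>j<m. alt_entry a q j * x j))"
      using a q(1) by (simp add: S_def)
    moreover have "(\<Sum>j<m. alt_entry a q j * x j)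
        = ?s * a l * x p + (\<Sum>j\<in>{..<m} - {p}. alt_entry a q j * x j)"
      using p by (subst sum.remove[of _ p]) (auto simp: alt_entry_def l insert_commute)
    ultimately have "4 dvd (?s * ?s) * a l * x p
        + ?s * (y q + (\<Sum>j\<in>{..<m} - {p}. alt_entry a q j * x j))"
      by (simp add: algebra_simps)
    then have "4 dvd a l * x p
        + ?s * (y q + (\<Sum>j\<in>{..<m} - {p}. alt_entry (restrict a (pairs m - L)) q j * x j))"
      unfolding s by (simp add: restr)
    then show "a l \<in> T (restrict a (pairs m - L)) l" using al by (simp add: T_def the)
  qed (use L_sub finite_pairs in auto)
  then have "card S * 4 ^ (m - 1) \<le> 4 ^ card (pairs m - L) * g ^ card L * 4 ^ (m - 1)"
    by simp
  also have "\<dots> = 4 ^ (card (pairs m - L) + card L) * g ^ (m - 1)"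
    by (simp add: card_L power_add)
  also have "card (pairs m - L) + card L = card (pairs m)"
    using L_sub finite_pairs[of m] card_mono[of "pairs m" L] card_Diff_subset[of L "pairs m"]
      finite_subset[of L "pairs m"] by simp
  also have "4 ^ card (pairs m) = card (alt_params m)"
    by (simp add: alt_params_def card_PiE finite_pairs)
  finally show ?thesis unfolding S_def .
qed

lemma card_residues_odd_le:
  fixes c r :: int
  assumes "odd c"
  shows "card {t \<in> {0..3}. 4 dvd t * c + r} \<le> 1"
proof -
  have "t = t'" if "t \<in> {0..3}" "t' \<in> {0..3}" "4 dvd t * c + r" "4 dvd t' * c + r" for t t'
  proof -
    have "4 dvd (t * c + r) - (t' * c + r)" using that by (intro dvd_diff)
    then have "4 dvd (t - t') * c" by (simp add: algebra_simps)
    moreover have "coprime 4 c"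
      using assms coprime_power_left_iff[of 2 2 c] by simp
    ultimately have "4 dvd t - t'" by (simp add: coprime_dvd_mult_left_iff)
    moreover have "\<bar>t - t'\<bar> < 4" using that(1,2) by auto
    ultimately show "t = t'" using dvd_imp_le_int[of "t - t'" 4] by auto
  qed
  moreover have "finite {t \<in> {0..3}. 4 dvd t * c + r}" by (rule finite_Collect_conjI) simp
  ultimately show ?thesis unfolding One_nat_def by (subst card_le_Suc0_iff_eq) blast+
qed

text \<open>Two solutions differing by 1 would give \<open>4 dvd c\<close>, so each of {0, 1} and
  {2, 3} contains at most one.\<close>

lemma card_residues_not_dvd_le:
  fixes c r :: int
  assumes "\<not> 4 dvd c"
  shows "card {t \<in> {0..3}. 4 dvd t * c + r} \<le> 2"
proof -
  have "inj_on (\<lambda>t. t div 2) {t \<in> {0..3}. 4 dvd t * c + r}"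
  proof (rule inj_onI, rule ccontr)
    fix t t' :: int
    assume t: "t \<in> {t \<in> {0..3}. 4 dvd t * c + r}" "t' \<in> {t \<in> {0..3}. 4 dvd t * c + r}"
      "t div 2 = t' div 2" "t \<noteq> t'"
    have "t - t' = 1 \<or> t - t' = - 1" using t(3,4) by presburger
    moreover have "4 dvd (t * c + r) - (t' * c + r)" using t(1,2) by (intro dvd_diff) simp_all
    then have "4 dvd (t - t') * c" by (simp add: left_diff_distrib)
    ultimately show False using assms by (elim disjE) simp_all
  qed
  moreover have "(\<lambda>t. t div 2) ` {t \<in> {0..3}. 4 dvd t * c + r} \<subseteq> {0, 1}"
  proof (rule image_subsetI)
    fix t :: int assume "t \<in> {t \<in> {0..3}. 4 dvd t * c + r}"
    then have "0 \<le> t" "t \<le> 3" by simp_all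
    then show "t div 2 \<in> {0, 1}" by simp linarith
  qed
  ultimately have "card {t \<in> {0..3}. 4 dvd t * c + r} \<le> card {0, 1 :: int}"
    by (meson card_inj_on_le finite.emptyI finite.insertI)
  then show ?thesis by simp
qed

section \<open>Integer lifts of \<open>z4\<close> vectors, and dual codes\<close>

lemma z4_of_int_eq_0_iff: "(of_int k :: z4) = 0 \<longleftrightarrow> 4 dvd k"
  using of_int_eq_0_iff_char_dvd[of k, where 'a = z4] by simp

lemma z4_cases: "(x :: z4) = 0 \<or> x = 1 \<or> x = 2 \<or> x = 3"
proof (cases x)
  case (of_int z)
  then have "z = 0 \<or> z = 1 \<or> z = 2 \<or> z = 3" by auto
  then show ?thesis using of_int by auto
qed

text \<open>Integer representatives make parity and congruences modulo 8 expressible.\<close>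

definition z4_lift :: "z4 \<Rightarrow> int" where
  "z4_lift x = (if x = 0 then 0 else if x = 1 then 1 else if x = 2 then 2 else 3)"

lemma of_int_z4_lift [simp]: "of_int (z4_lift x) = x"
  using z4_cases[of x] by (auto simp: z4_lift_def)

lemma even_z4_lift_iff: "even (z4_lift x) \<longleftrightarrow> x = 0 \<or> x = 2"
  using z4_cases[of x] by (auto simp: z4_lift_def)

lemma Lee_odd: "odd (z4_lift x) \<Longrightarrow> Lee x = 1"
  using z4_cases[of x] by (auto simp: z4_lift_def Lee_def)

definition z4_vec :: "nat \<Rightarrow> (nat \<Rightarrow> int) \<Rightarrow> z4 vec" where
  "z4_vec n w = vec n (\<lambda>k. of_int (w k))"

definition lift_vec :: "z4 vec \<Rightarrow> nat \<Rightarrow> int" where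
  "lift_vec v k = z4_lift (v $ k)"

lemma z4_vec_carrier [simp]: "z4_vec n w \<in> carrier_vec n"
  by (simp add: z4_vec_def)

lemma z4_vec_lift_vec: "v \<in> carrier_vec n \<Longrightarrow> z4_vec n (lift_vec v) = v"
  by (auto simp: z4_vec_def lift_vec_def)

lemma scalar_prod_z4_vec: "z4_vec n v \<bullet> z4_vec n w = of_int (int_inner n v w)"
  by (simp add: scalar_prod_def z4_vec_def int_inner_def lessThan_atLeast0)

text \<open>Only the lift 3 differs from its Lee weight, and 9 is 1 modulo 8.\<close>

lemma euclidean_norm_lift_vec:
  assumes "v \<in> carrier_vec n"
  shows "8 dvd int_inner n (lift_vec v) (lift_vec v) - int (euclidean_norm v)"
proof -
  have "8 dvd z4_lift x * z4_lift x - (int (Lee x))\<^sup>2" for x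
    using z4_cases[of x] by (auto simp: z4_lift_def Lee_def)
  then have "8 dvd (\<Sum>k<n. lift_vec v k * lift_vec v k - (int (Lee (v $ k)))\<^sup>2)"
    by (intro dvd_sum) (simp add: lift_vec_def)
  then show ?thesis
    using assms by (simp add: int_inner_def euclidean_norm_def sum_subtractf)
qed

lemma z4_code_dual_code:
  assumes "S \<subseteq> carrier_vec n"
  shows "z4_code n (dual_code n S)"
proof -
  interpret vec_module "TYPE(z4)" n .
  show ?thesis unfolding z4_code_def
  proof (rule submoduleI)
    fix x assume x: "x \<in> dual_code n S"
    then have "\<ominus>\<^bsub>module_vec TYPE(z4) n\<^esub> x = - x"
      by (intro minus_equality) (auto simp: dual_code_def)
    moreover have "- x \<bullet> y = 0" if "y \<in> S" for y
      using x that assms by (subst scalar_prod_uminus_left) (auto simp: dual_code_def)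
    ultimately show "\<ominus>\<^bsub>module_vec TYPE(z4) n\<^esub> x \<in> dual_code n S"
      using x by (simp add: dual_code_def)
  next
    fix x y assume xy: "x \<in> dual_code n S" "y \<in> dual_code n S"
    have "(x + y) \<bullet> z = 0" if "z \<in> S" for z
      using xy that assms by (subst add_scalar_prod_distrib[of _ n]) (auto simp: dual_code_def)
    then show "x + y \<in> dual_code n S" using xy by (simp add: dual_code_def)
  next
    fix c x assume x: "x \<in> dual_code n S"
    have "(c \<cdot>\<^sub>v x) \<bullet> z = 0" if "z \<in> S" for z
      using x that assms by (subst smult_scalar_prod_distrib[of _ n]) (auto simp: dual_code_def)
    then show "c \<cdot>\<^sub>v x \<in> dual_code n S" using x by (simp add: dual_code_def)
  qed (use assms in \<open>auto simp: dual_code_def\<close>)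
qed

section \<open>The Type II code of an alternating matrix\<close>

context hyperbolic_frame
begin

definition generator :: "(nat set \<Rightarrow> int) \<Rightarrow> nat \<Rightarrow> nat \<Rightarrow> int" where
  "generator a i = (\<lambda>k. e i k + (\<Sum>j<m. alt_entry a i j * f j k))"

text \<open>Taking the dual of the generators instead of their span makes membership a system of
  congruences, namely \<open>in_code\<close>.\<close>

definition code :: "(nat set \<Rightarrow> int) \<Rightarrow> z4 vec set" where
  "code a = dual_code n (insert (z4_vec n (\<lambda>_. 1)) ((\<lambda>i. z4_vec n (generator a i)) ` {..<m}))"

definition in_code :: "(nat set \<Rightarrow> int) \<Rightarrow> (nat \<Rightarrow> int) \<Rightarrow> bool" where
  "in_code a w \<longleftrightarrow> 4 dvd int_inner n w (\<lambda>_. 1) \<and>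
    (\<forall>i<m. 4 dvd int_inner n w (e i) + (\<Sum>j<m. alt_entry a i j * int_inner n w (f j)))"

lemma inner_generator:
  "int_inner n w (generator a i)
    = int_inner n w (e i) + (\<Sum>j<m. alt_entry a i j * int_inner n w (f j))"
  unfolding generator_def int_inner_add_right int_inner_sum_right ..

lemma z4_vec_in_code_iff: "z4_vec n w \<in> code a \<longleftrightarrow> in_code a w"
  unfolding code_def dual_code_def in_code_def inner_generator[symmetric]
  by (auto simp: scalar_prod_z4_vec z4_of_int_eq_0_iff)

lemma in_code_iff: "v \<in> code a \<longleftrightarrow> v \<in> carrier_vec n \<and> in_code a (lift_vec v)"
proof (cases "v \<in> carrier_vec n")
  case True
  then show ?thesis using z4_vec_in_code_iff[of "lift_vec v" a] by (simp add: z4_vec_lift_vec)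
qed (simp add: code_def dual_code_def)

lemma in_code_one: "in_code a (\<lambda>_. 1)"
  unfolding in_code_def using four_dvd_size one_e one_f
  by (auto intro!: dvd_add dvd_sum)

lemma in_code_add: "in_code a v \<Longrightarrow> in_code a w \<Longrightarrow> in_code a (\<lambda>k. v k + w k)"
proof -
  assume vw: "in_code a v" "in_code a w"
  have "4 dvd int_inner n (\<lambda>k. v k + w k) (generator a i)" if "i < m" for i
    using vw that unfolding int_inner_add_left in_code_def inner_generator by (simp add: dvd_add)
  then show ?thesis
    using vw unfolding in_code_def inner_generator by (simp add: int_inner_add_left)
qed

text \<open>Generator \<open>l\<close> has product \<open>alt_entry a l i\<close> with
  \<open>e i\<close> and Kronecker delta with \<open>f i\<close>, so congruence \<open>i\<close>
  becomes antisymmetry of the matrix.\<close>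

lemma in_code_generator:
  assumes l: "l < m"
  shows "in_code a (generator a l)"
proof -
  \<comment> \<open>Congruences become equations in \<open>z4\<close>, so that sums against
    Kronecker deltas can be evaluated by simplification.\<close>
  have ee: "(of_int (int_inner n (e i) (e j)) :: z4) = 0" if "i < m" "j < m" for i j
    using e_e that by (simp add: z4_of_int_eq_0_iff)
  have ff: "(of_int (int_inner n (f i) (f j)) :: z4) = 0" if "i < m" "j < m" for i j
    using f_f that by (simp add: z4_of_int_eq_0_iff)
  have ef: "(of_int (int_inner n (e i) (f j)) :: z4) = (if i = j then 1 else 0)" if "i < m" "j < m" for i j
    using e_f[OF that] z4_of_int_eq_0_iff[of "int_inner n (e i) (f j) - (if i = j then 1 else 0)"]
    by (auto split: if_splits)
  have one: "4 dvd int_inner n (generator a l) (\<lambda>_. 1)"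
    unfolding int_inner_commute[of n _ "\<lambda>_. 1"] inner_generator
    using l one_e one_f by (auto intro!: dvd_add dvd_sum)
  have ge: "(of_int (int_inner n (generator a l) (e i)) :: z4) = of_int (alt_entry a l i)"
    if "i < m" for i
    using l that unfolding int_inner_commute[of n _ "e i"] inner_generator
    by (simp add: ee ef if_distrib[of "\<lambda>x. _ * x"] cong: if_cong)
  have gf: "(of_int (int_inner n (generator a l) (f i)) :: z4) = (if l = i then 1 else 0)"
    if "i < m" for i
    using l that unfolding int_inner_commute[of n _ "f i"] inner_generator
    by (simp add: ff ef int_inner_commute[of n "f i"])
  have "4 dvd int_inner n (generator a l) (e i)
      + (\<Sum>j<m. alt_entry a i j * int_inner n (generator a l) (f j))" if "i < m" for i
    unfolding z4_of_int_eq_0_iff[symmetric]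
    using l that
    by (simp add: ge gf if_distrib[of "\<lambda>x. _ * x"] alt_entry_antisym[of a i l] cong: if_cong)
  then show ?thesis using one unfolding in_code_def by blast
qed

text \<open>Substituting the congruences for \<open>?y\<close> turns the sum of
  \<open>?y i * ?x i\<close> into minus the quadratic form of the matrix, so it is 0 mod 4. Its
  factor 2 in \<open>norm\<close> gives 8, and the other terms contain the product with the all-ones
  vector, a multiple of 4.\<close>

lemma in_code_norm:
  assumes "in_code a v"
  shows "8 dvd int_inner n v v"
proof -
  let ?x = "\<lambda>i. int_inner n v (f i)" and ?y = "\<lambda>i. int_inner n v (e i)"
  obtain c where c: "int_inner n v (\<lambda>_. 1) = 4 * c" using assms by (auto simp: in_code_def)
  have "4 dvd (\<Sum>i<m. ?x i * (?y i + (\<Sum>j<m. alt_entry a i j * ?x j)))"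
    using assms by (intro dvd_sum dvd_mult) (auto simp: in_code_def)
  also have "(\<Sum>i<m. ?x i * (?y i + (\<Sum>j<m. alt_entry a i j * ?x j))) = (\<Sum>i<m. ?y i * ?x i)"
    using alt_entry_quadratic[where x = ?x and a = a and m = m]
    by (simp add: distrib_left sum.distrib sum_distrib_left mult.commute)
  finally obtain d where d: "(\<Sum>i<m. ?y i * ?x i) = 4 * d" by (elim dvdE)
  have "8 dvd (int_inner n v v - (2 * (4 * d) + 2 * (4 * c) * int_inner n v u - (4 * c)\<^sup>2))
      + 8 * (d + c * int_inner n v u - 2 * c\<^sup>2)"
    using norm[of v] unfolding c d by (rule dvd_add) (rule dvd_triv_left)
  also have "\<dots> = int_inner n v v" by (simp add: power2_eq_square algebra_simps)
  finally show ?thesis .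
qed

text \<open>Polarisation of \<open>in_code_norm\<close>.\<close>

lemma in_code_inner:
  assumes "in_code a v" "in_code a w"
  shows "4 dvd int_inner n v w"
proof -
  have "8 dvd int_inner n (\<lambda>k. v k + w k) (\<lambda>k. v k + w k) - int_inner n v v - int_inner n w w"
    using assms by (intro dvd_diff in_code_norm in_code_add)
  then have "8 dvd 2 * int_inner n v w"
    by (simp add: int_inner_add_left int_inner_add_right int_inner_commute[of n w v])
  then show ?thesis by presburger
qed

text \<open>Self-orthogonality is \<open>in_code_inner\<close>. Conversely the code contains its
  generators, so anything orthogonal to the code is orthogonal to them and hence a codeword.\<close>

lemma type_II_code: "type_II_code n (code a)"
proof -
  let ?S = "insert (z4_vec n (\<lambda>_. 1)) ((\<lambda>i. z4_vec n (generator a i)) ` {..<m})"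
  have sub: "?S \<subseteq> code a"
    by (auto simp: z4_vec_in_code_iff in_code_one in_code_generator)
  have "z4_code n (code a)" unfolding code_def by (rule z4_code_dual_code) auto
  moreover have "code a \<subseteq> dual_code n (code a)"
  proof
    fix v assume v: "v \<in> code a"
    have "v \<bullet> w = 0" if w: "w \<in> code a" for w
    proof -
      have "4 dvd int_inner n (lift_vec v) (lift_vec w)"
        using v w by (intro in_code_inner) (auto simp: in_code_iff)
      then show ?thesis
        using scalar_prod_z4_vec[of n "lift_vec v" "lift_vec w"] v w
        by (simp add: in_code_iff z4_vec_lift_vec z4_of_int_eq_0_iff)
    qed
    then show "v \<in> dual_code n (code a)" using v by (simp add: dual_code_def in_code_iff)
  qed
  moreover have "dual_code n (code a) \<subseteq> code a"
    using sub by (subst (2) code_def) (auto simp: dual_code_def)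
  moreover have "8 dvd euclidean_norm v" if "v \<in> code a" for v
  proof -
    have "v \<in> carrier_vec n" "8 dvd int_inner n (lift_vec v) (lift_vec v)"
      using that in_code_norm by (auto simp: in_code_iff)
    then have "8 dvd int_inner n (lift_vec v) (lift_vec v)
        - (int_inner n (lift_vec v) (lift_vec v) - int (euclidean_norm v))"
      by (intro dvd_diff euclidean_norm_lift_vec)
    then have "8 dvd int (euclidean_norm v)" by simp
    then show ?thesis by presburger
  qed
  ultimately show ?thesis unfolding type_II_code_def self_dual_code_def by blast
qed

section \<open>Coordinates of light codewords\<close>

lemma inner_expand:
  "4 dvd int_inner n v w
    - ((\<Sum>i<m. int_inner n v (e i) * int_inner n w (f i) + int_inner n w (e i) * int_inner n v (f i))
       + int_inner n v (\<lambda>_. 1) * int_inner n w u + int_inner n w (\<lambda>_. 1) * int_inner n v u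
       - int_inner n v (\<lambda>_. 1) * int_inner n w (\<lambda>_. 1))" (is "4 dvd ?D")
proof -
  let ?N = "\<lambda>v. int_inner n v v
      - (2 * (\<Sum>i<m. int_inner n v (e i) * int_inner n v (f i))
         + 2 * int_inner n v (\<lambda>_. 1) * int_inner n v u - (int_inner n v (\<lambda>_. 1))\<^sup>2)"
  \<comment> \<open>Polarising \<open>norm\<close> gives twice the claim modulo 8.\<close>
  have "8 dvd ?N (\<lambda>k. v k + w k) - ?N v - ?N w" by (intro dvd_diff norm)
  also have "?N (\<lambda>k. v k + w k) - ?N v - ?N w = 2 * ?D"
    by (simp add: int_inner_add_left int_inner_add_right int_inner_commute[of n w v]
        sum.distrib power2_eq_square algebra_simps)
  finally show ?thesis by presburger
qed

text \<open>Take \<open>w\<close> in \<open>inner_expand\<close> to be the unit vector at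
  \<open>k\<close>, whose product with any vector is that vector's entry at
  \<open>k\<close>.\<close>

lemma coordinate_expand:
  assumes "k < n" "4 dvd int_inner n v (\<lambda>_. 1)"
  shows "4 dvd v k - int_inner n v u - (\<Sum>i<m. int_inner n v (e i) * f i k + e i k * int_inner n v (f i))"
proof -
  define w :: "nat \<Rightarrow> int" where "w j = (if j = k then 1 else 0)" for j
  have w: "int_inner n w z = z k" "int_inner n z w = z k" for z
    using assms(1) by (simp_all add: int_inner_def w_def if_distrib if_distribR cong: if_cong)
  obtain c where c: "int_inner n v (\<lambda>_. 1) = 4 * c" using assms by blast
  let ?s = "\<Sum>i<m. int_inner n v (e i) * f i k + e i k * int_inner n v (f i)"
  have "4 dvd (v k - (?s + 4 * c * u k + 1 * int_inner n v u - 4 * c * 1)) + 4 * (c * (u k - 1))"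
    using inner_expand[of v w] unfolding w c by (rule dvd_add) (rule dvd_triv_left)
  also have "\<dots> = v k - int_inner n v u - ?s" by (simp add: algebra_simps)
  finally show ?thesis .
qed

text \<open>If \<open>d\<close> is 2 or 4 and divides every \<open>?x i\<close>, the code
  congruences make it divide every \<open>?y i\<close>, so all entries agree with \<open>?b\<close>
  mod \<open>d\<close>. For 2, the entries share a parity, and all odd would mean weight
  \<open>n\<close>. For 4, the word is constant, and a nonzero constant has weight at least
  \<open>n\<close>.\<close>

lemma light_codeword_cases:
  assumes v: "v \<in> code a" and "v \<noteq> 0\<^sub>v n" and "lee_weight v < n"
  obtains p where "p < m" "odd (int_inner n (lift_vec v) (f p))"
  | p where "p < m" "\<not> 4 dvd int_inner n (lift_vec v) (f p)" "\<forall>k<n. v $ k \<in> {0, 2}"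
proof -
  let ?x = "\<lambda>i. int_inner n (lift_vec v) (f i)" and ?y = "\<lambda>i. int_inner n (lift_vec v) (e i)"
  let ?b = "int_inner n (lift_vec v) u"
  have carr: "v \<in> carrier_vec n" and one: "4 dvd int_inner n (lift_vec v) (\<lambda>_. 1)"
    and rows: "\<And>i. i < m \<Longrightarrow> 4 dvd ?y i + (\<Sum>j<m. alt_entry a i j * ?x j)"
    using v by (auto simp: in_code_iff in_code_def)
  have n: "n > 0" by (simp add: size)
  have congr: "d dvd lift_vec v k - ?b" if d: "d dvd 4" "\<forall>i<m. d dvd ?x i" "k < n" for d k
  proof -
    have y: "d dvd ?y i" if "i < m" for i
    proof -
      have "d dvd ?y i + (\<Sum>j<m. alt_entry a i j * ?x j)" using rows[OF that] d(1) dvd_trans by blast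
      moreover have "d dvd (\<Sum>j<m. alt_entry a i j * ?x j)" using d(2) by (intro dvd_sum) auto
      ultimately show ?thesis by (metis dvd_add_left_iff)
    qed
    have "d dvd lift_vec v k - ?b - (\<Sum>i<m. ?y i * f i k + e i k * ?x i)"
      using coordinate_expand[OF d(3) one] d(1) dvd_trans by blast
    moreover have "d dvd (\<Sum>i<m. ?y i * f i k + e i k * ?x i)"
      using d(2) y by (intro dvd_sum dvd_add) auto
    ultimately show ?thesis by (metis dvd_add diff_add_cancel)
  qed
  have weight: "lee_weight v = (\<Sum>k<n. Lee (v $ k))" using carr by (simp add: lee_weight_def)
  show thesis
  proof (cases "\<exists>p<m. odd (?x p)")
    case True
    then show ?thesis using that(1) by blast
  next
    case even: False
    then have par: "even (lift_vec v k) \<longleftrightarrow> even ?b" if "k < n" for k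
      using congr[of 2 k] that by simp
    have b: "even ?b"
    proof (rule ccontr)
      assume "odd ?b"
      then have "lee_weight v = (\<Sum>k<n. 1)"
        unfolding weight using par by (intro sum.cong) (simp_all add: lift_vec_def Lee_odd)
      then show False using assms(3) by simp
    qed
    have entries: "\<forall>k<n. v $ k \<in> {0, 2}"
      using par b by (auto simp: lift_vec_def even_z4_lift_iff)
    have "\<exists>p<m. \<not> 4 dvd ?x p"
    proof (rule ccontr)
      assume "\<not> ?thesis"
      then have "4 dvd lift_vec v k - ?b" if "k < n" for k using congr[of 4 k] that by auto
      then have const: "v $ k = of_int ?b" if "k < n" for k
        using that z4_of_int_eq_0_iff[of "lift_vec v k - ?b"] by (simp add: lift_vec_def)
      have "(of_int ?b :: z4) \<noteq> 0"
      proof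
        assume "(of_int ?b :: z4) = 0"
        then have "v = 0\<^sub>v n" using const carr by (intro eq_vecI) auto
        then show False using assms(2) by simp
      qed
      then have "(\<Sum>k<n. 1) \<le> lee_weight v"
        unfolding weight by (intro sum_mono) (auto simp: const Lee_def)
      then show False using assms(3) by simp
    qed
    then show ?thesis using that(2) entries by blast
  qed
qed

end

section \<open>Chernoff bound for vectors of small Lee weight\<close>

lemma carrier_vec_entries_eq_image:
  "{v \<in> carrier_vec n. \<forall>k<n. v $ k \<in> D} = vec n ` (\<Pi>\<^sub>E k\<in>{..<n}. D)"
proof
  show "{v \<in> carrier_vec n. \<forall>k<n. v $ k \<in> D} \<subseteq> vec n ` (\<Pi>\<^sub>E k\<in>{..<n}. D)"
  proof
    fix v assume v: "v \<in> {v \<in> carrier_vec n. \<forall>k<n. v $ k \<in> D}"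
    then have "v = vec n (restrict (\<lambda>k. v $ k) {..<n})" by (intro eq_vecI) simp_all
    moreover have "restrict (\<lambda>k. v $ k) {..<n} \<in> (\<Pi>\<^sub>E k\<in>{..<n}. D)" using v by simp
    ultimately show "v \<in> vec n ` (\<Pi>\<^sub>E k\<in>{..<n}. D)" by blast
  qed
  show "vec n ` (\<Pi>\<^sub>E k\<in>{..<n}. D) \<subseteq> {v \<in> carrier_vec n. \<forall>k<n. v $ k \<in> D}"
  proof (rule image_subsetI)
    fix h assume "h \<in> (\<Pi>\<^sub>E k\<in>{..<n}. D)"
    then have "h k \<in> D" if "k < n" for k using that by (simp add: PiE_iff)
    then show "vec n h \<in> {v \<in> carrier_vec n. \<forall>k<n. v $ k \<in> D}" by simp
  qed
qed

lemma finite_carrier_vec: "finite (carrier_vec n :: 'a :: finite vec set)"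
proof -
  have "carrier_vec n = vec n ` (\<Pi>\<^sub>E k\<in>{..<n}. UNIV :: 'a set)"
    using carrier_vec_entries_eq_image[of n "UNIV :: 'a set"] by simp
  then show ?thesis by (simp add: finite_PiE)
qed

text \<open>Additivity of the Lee weight factorises its generating function over the
  coordinates.\<close>

lemma sum_power_lee_weight:
  fixes s :: real
  shows "(\<Sum>v | v \<in> carrier_vec n \<and> (\<forall>k<n. v $ k \<in> D). s ^ lee_weight v) = (\<Sum>t\<in>D. s ^ Lee t) ^ n"
proof -
  have inj: "inj_on (vec n) (\<Pi>\<^sub>E k\<in>{..<n}. D)"
  proof (rule inj_onI, rule PiE_ext)
    fix g h and k :: nat
    assume "vec n g = vec n h" "k \<in> {..<n}"
    then show "g k = h k" by (metis index_vec lessThan_iff)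
  qed
  have "(\<Sum>v | v \<in> carrier_vec n \<and> (\<forall>k<n. v $ k \<in> D). s ^ lee_weight v)
      = (\<Sum>h\<in>(\<Pi>\<^sub>E k\<in>{..<n}. D). \<Prod>k<n. s ^ Lee (h k))"
    unfolding carrier_vec_entries_eq_image sum.reindex[OF inj]
    by (simp add: lee_weight_def power_sum)
  also have "\<dots> = (\<Prod>k<n. \<Sum>t\<in>D. s ^ Lee t)"
    by (subst prod_sum_PiE) simp_all
  finally show ?thesis by simp
qed

text \<open>As \<open>s\<close> is at most 1, every counted vector contributes at least
  \<open>s powr c\<close> to the generating function.\<close>

lemma card_light_vectors_le:
  fixes s c :: real and D :: "z4 set"
  assumes s: "0 < s" "s \<le> 1"
  shows "real (card {v \<in> carrier_vec n. (\<forall>k<n. v $ k \<in> D) \<and> real (lee_weight v) < c})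
    \<le> (\<Sum>t\<in>D. s ^ Lee t) ^ n * s powr (- c)"
proof -
  let ?S = "{v \<in> carrier_vec n. (\<forall>k<n. v $ k \<in> D) \<and> real (lee_weight v) < c}"
  let ?V = "{v \<in> carrier_vec n. \<forall>k<n. v $ k \<in> D}"
  have fin: "finite ?V" by (rule finite_subset[OF _ finite_carrier_vec[of n]]) auto
  have "real (card ?S) * s powr c = (\<Sum>v\<in>?S. s powr c)" by simp
  also have "\<dots> \<le> (\<Sum>v\<in>?S. s ^ lee_weight v)"
  proof (rule sum_mono)
    fix v assume "v \<in> ?S"
    then have "s powr c \<le> s powr real (lee_weight v)" using s by (intro powr_mono') auto
    then show "s powr c \<le> s ^ lee_weight v" using s by (simp add: powr_realpow)
  qed
  also have "\<dots> \<le> (\<Sum>v\<in>?V. s ^ lee_weight v)"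
    using fin s by (intro sum_mono2) auto
  also have "\<dots> = (\<Sum>t\<in>D. s ^ Lee t) ^ n" by (rule sum_power_lee_weight)
  finally show ?thesis using s by (simp add: powr_minus field_simps)
qed

section \<open>Union bound over light vectors\<close>

context hyperbolic_frame
begin

lemma ex_code_without_light_words:
  fixes c :: real
  assumes c: "c \<le> real n"
    and small: "real (card {v \<in> carrier_vec n. real (lee_weight v) < c}) / 4 ^ (m - 1)
      + real (card {v \<in> carrier_vec n. (\<forall>k<n. v $ k \<in> {0, 2}) \<and> real (lee_weight v) < c}) / 2 ^ (m - 1) < 1"
  shows "\<exists>a. \<forall>v\<in>code a. v \<noteq> 0\<^sub>v n \<longrightarrow> c \<le> real (lee_weight v)"
proof (rule ccontr)
  assume contr: "\<not> ?thesis"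
  define W1 where "W1 = {v \<in> carrier_vec n. real (lee_weight v) < c}"
  define W2 where "W2 = {v \<in> carrier_vec n. (\<forall>k<n. v $ k \<in> {0, 2}) \<and> real (lee_weight v) < c}"
  define V1 where "V1 = {v \<in> W1. \<exists>p<m. odd (int_inner n (lift_vec v) (f p))}"
  define V2 where "V2 = {v \<in> W2. \<exists>p<m. \<not> 4 dvd int_inner n (lift_vec v) (f p)}"
  define N where "N = real (card (alt_params m))"
  let ?S = "\<lambda>v. {a \<in> alt_params m. \<forall>i<m. 4 dvd int_inner n (lift_vec v) (e i)
    + (\<Sum>j<m. alt_entry a i j * int_inner n (lift_vec v) (f j))}"
  have finW: "finite W1" "finite W2"
    unfolding W1_def W2_def by (rule finite_subset[OF _ finite_carrier_vec[of n]], auto)+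
  then have fin: "finite V1" "finite V2" unfolding V1_def V2_def by auto
  have N: "N > 0" using finite_alt_params alt_params_nonempty by (simp add: N_def card_gt_0_iff)
  \<comment> \<open>If every code had a light word, every matrix would solve the system of some
    vector in \<open>V1\<close> or \<open>V2\<close>.\<close>
  have cover: "alt_params m \<subseteq> (\<Union>v\<in>V1. ?S v) \<union> (\<Union>v\<in>V2. ?S v)"
  proof
    fix a assume a: "a \<in> alt_params m"
    obtain v where v: "v \<in> code a" "v \<noteq> 0\<^sub>v n" "real (lee_weight v) < c"
      using contr by (auto simp: not_le)
    then have "v \<in> carrier_vec n" "a \<in> ?S v" using a by (auto simp: in_code_iff in_code_def)
    moreover have "lee_weight v < n" using v(3) c by linarith
    with v(1,2) have "v \<in> V1 \<or> v \<in> V2"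
    proof (cases rule: light_codeword_cases)
      case (1 p)
      then have "v \<in> V1" using v(3) \<open>v \<in> carrier_vec n\<close> unfolding V1_def W1_def by blast
      then show ?thesis ..
    next
      case (2 p)
      then have "v \<in> V2" using v(3) \<open>v \<in> carrier_vec n\<close> unfolding V2_def W2_def by blast
      then show ?thesis ..
    qed
    ultimately show "a \<in> (\<Union>v\<in>V1. ?S v) \<union> (\<Union>v\<in>V2. ?S v)" by blast
  qed
  have S1: "real (card (?S v)) \<le> N / 4 ^ (m - 1)" if v: "v \<in> V1" for v
  proof -
    obtain p where p: "p < m" "odd (int_inner n (lift_vec v) (f p))" using v by (auto simp: V1_def)
    have "card (?S v) * 4 ^ (m - 1) \<le> card (alt_params m) * 1 ^ (m - 1)"
      by (rule card_alt_solutions_le[OF p(1)]) (rule card_residues_odd_le[OF p(2)])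
    then have "real (card (?S v) * 4 ^ (m - 1)) \<le> N"
      unfolding N_def of_nat_le_iff by simp
    then show ?thesis by (simp add: field_simps)
  qed
  have S2: "real (card (?S v)) \<le> N / 2 ^ (m - 1)" if v: "v \<in> V2" for v
  proof -
    obtain p where p: "p < m" "\<not> 4 dvd int_inner n (lift_vec v) (f p)" using v by (auto simp: V2_def)
    have "card (?S v) * 4 ^ (m - 1) \<le> card (alt_params m) * 2 ^ (m - 1)"
      by (rule card_alt_solutions_le[OF p(1)]) (rule card_residues_not_dvd_le[OF p(2)])
    moreover have "(4 :: nat) ^ (m - 1) = 2 ^ (m - 1) * 2 ^ (m - 1)"
      by (simp flip: power_mult_distrib)
    ultimately have "card (?S v) * 2 ^ (m - 1) \<le> card (alt_params m)" by simp
    then have "real (card (?S v) * 2 ^ (m - 1)) \<le> N"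
      unfolding N_def of_nat_le_iff .
    then show ?thesis by (simp add: field_simps)
  qed
  have finS: "finite (?S v)" for v
    by (rule finite_subset[OF _ finite_alt_params[of m]]) auto
  have "card (alt_params m) \<le> card ((\<Union>v\<in>V1. ?S v) \<union> (\<Union>v\<in>V2. ?S v))"
    using fin finS by (intro card_mono[OF _ cover]) auto
  also have "\<dots> \<le> card (\<Union>v\<in>V1. ?S v) + card (\<Union>v\<in>V2. ?S v)" by (rule card_Un_le)
  also have "\<dots> \<le> (\<Sum>v\<in>V1. card (?S v)) + (\<Sum>v\<in>V2. card (?S v))"
    by (intro add_mono card_UN_le fin)
  finally have "N \<le> real ((\<Sum>v\<in>V1. card (?S v)) + (\<Sum>v\<in>V2. card (?S v)))"
    unfolding N_def of_nat_le_iff .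
  also have "\<dots> = (\<Sum>v\<in>V1. real (card (?S v))) + (\<Sum>v\<in>V2. real (card (?S v)))"
    by simp
  also have "\<dots> \<le> (\<Sum>v\<in>V1. N / 4 ^ (m - 1)) + (\<Sum>v\<in>V2. N / 2 ^ (m - 1))"
    by (intro add_mono sum_mono S1 S2)
  also have "\<dots> \<le> real (card W1) * (N / 4 ^ (m - 1)) + real (card W2) * (N / 2 ^ (m - 1))"
  proof -
    have "card V1 \<le> card W1" "card V2 \<le> card W2"
      using finW by (auto intro!: card_mono simp: V1_def V2_def)
    then show ?thesis using N by (auto intro!: add_mono mult_right_mono divide_right_mono)
  qed
  also have "\<dots> = N * (real (card W1) / 4 ^ (m - 1) + real (card W2) / 2 ^ (m - 1))"
    by (simp add: algebra_simps)
  also have "\<dots> < N * 1"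
    using small N unfolding W1_def W2_def by (intro mult_strict_left_mono)
  finally show False by simp
qed

text \<open>This keeps the set in \<open>min_lee_weight\<close> nonempty, where \<open>Min\<close>
  is meaningful.\<close>

lemma one_in_code: "z4_vec n (\<lambda>_. 1) \<in> code a - {0\<^sub>v n}"
proof -
  have "z4_vec n (\<lambda>_. 1) $ 0 = 1" "0\<^sub>v n $ 0 = (0 :: z4)" using size by (simp_all add: z4_vec_def)
  then have "z4_vec n (\<lambda>_. 1) \<noteq> 0\<^sub>v n" by auto
  then show ?thesis by (simp add: z4_vec_in_code_iff in_code_one)
qed

lemma min_lee_weight_code_ge:
  fixes c :: real
  assumes "\<forall>v\<in>code a. v \<noteq> 0\<^sub>v n \<longrightarrow> c \<le> real (lee_weight v)"
  shows "c \<le> real (min_lee_weight n (code a))"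
proof -
  have "finite (code a)"
    by (rule finite_subset[OF _ finite_carrier_vec[of n]]) (auto simp: in_code_iff)
  then have "min_lee_weight n (code a) \<in> lee_weight ` (code a - {0\<^sub>v n})"
    unfolding min_lee_weight_def using one_in_code[of a] by (intro Min_in) auto
  then show ?thesis using assms by auto
qed

end

section \<open>Asymptotics and the choice of the family\<close>

lemma eventually_ex_type_II_code:
  fixes \<delta> l :: real
  assumes d: "0 < \<delta>" "\<delta> < 1 / 2"
    and ent: "- \<delta> * log 2 \<delta> - (1 - \<delta>) * log 2 (1 - \<delta>) = 1 / 2"
    and l: "0 \<le> l" "l < \<delta>"
  shows "\<forall>\<^sub>F k in sequentially. \<exists>C. type_II_code (8 * (k + 1)) C \<and>
    l * (2 * real (8 * (k + 1))) \<le> real (min_lee_weight (8 * (k + 1)) C)"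
proof -
  \<comment> \<open>This value of \<open>s\<close> minimises
    \<open>(1 + s) * s powr (- \<delta>)\<close>; the minimum is 2 to the binary entropy of
    \<open>\<delta>\<close>, that is, the square root of 2.\<close>
  define r where "r = \<delta> / (1 - \<delta>)"
  define B where "B = (1 + r) * r powr (- l)"
  define \<beta> where "\<beta> = B\<^sup>2 / 2"
  have r: "0 < r" "r < 1" using d by (simp_all add: r_def field_simps)
  have B: "B > 0" using r by (simp add: B_def)
  have log_r: "log 2 r = log 2 \<delta> - log 2 (1 - \<delta>)" using d by (simp add: r_def log_divide)
  have "1 + r = 1 / (1 - \<delta>)" using d by (simp add: r_def field_simps)
  then have "log 2 (1 + r) = - log 2 (1 - \<delta>)" using d by (simp add: log_divide)
  then have "log 2 B = - log 2 (1 - \<delta>) - l * log 2 r"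
    using r by (simp add: B_def log_mult log_powr)
  \<comment> \<open>\<open>log 2 r\<close> is negative, so the expression increases strictly in
    \<open>l\<close>.\<close>
  also have "\<dots> < - log 2 (1 - \<delta>) - \<delta> * log 2 r"
    using l r by (simp add: mult_strict_right_mono_neg)
  also have "\<dots> = 1 / 2" unfolding ent[symmetric] log_r by (simp add: algebra_simps)
  finally have "log 2 (B\<^sup>2) < 1" using B by (simp add: log_nat_power)
  then have "B\<^sup>2 < 2" using B by (simp add: log_less_one_cancel_iff)
  then have \<beta>: "0 < \<beta>" "\<beta> < 1" using B by (simp_all add: \<beta>_def)
  \<comment> \<open>20 is 16 + 4. Since \<open>m - 1 = n / 2 - 2\<close>, the two terms of the union
    bound carry the factors \<open>2 ^ 4\<close> and \<open>2 ^ 2\<close>.\<close>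
  have "(\<lambda>k. 20 * \<beta> ^ k) \<longlonglongrightarrow> 20 * 0"
    using \<beta> by (intro tendsto_mult tendsto_const LIMSEQ_power_zero) auto
  then have "\<forall>\<^sub>F k in sequentially. 20 * \<beta> ^ k < 1" by (rule order_tendstoD) simp
  then show ?thesis
  proof eventually_elim
    case (elim k)
    define n where "n = 8 * (k + 1)"
    define m where "m = 4 * k + 3"
    define c where "c = l * (2 * real n)"
    obtain e f u where "hyperbolic_frame n m e f u"
      using hyperbolic_frame_exists unfolding n_def m_def by blast
    then interpret hyperbolic_frame n m e f u .
    have UNIV: "(UNIV :: z4 set) = {0, 1, 2, 3}" using z4_cases by auto
    have "(\<Sum>t\<in>UNIV. r ^ Lee t) = (1 + r)\<^sup>2"
      unfolding UNIV by (simp add: Lee_def power2_eq_square algebra_simps)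
    then have "real (card {v \<in> carrier_vec n. real (lee_weight v) < c}) \<le> ((1 + r)\<^sup>2) ^ n * r powr (- c)"
      using card_light_vectors_le[of r n UNIV c] r by simp
    also have "r powr (- c) = (r powr (- l)) ^ (2 * n)"
      using powr_power[of r "- l" "2 * n"] r by (simp add: c_def mult_ac)
    also have "((1 + r)\<^sup>2) ^ n * \<dots> = B ^ (2 * n)"
      unfolding B_def power_mult_distrib power_mult[symmetric] ..
    finally have 1: "real (card {v \<in> carrier_vec n. real (lee_weight v) < c}) \<le> B ^ (2 * n)" .
    \<comment> \<open>Over {0, 2} each nonzero entry weighs 2, so the parameter
      \<open>sqrt r\<close> yields the same base \<open>B\<close>, with exponent \<open>n\<close> in
      place of \<open>2 * n\<close>.\<close>
    have "(\<Sum>t\<in>{0, 2}. sqrt r ^ Lee t) = 1 + r"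
      using r by (simp add: Lee_def)
    then have "real (card {v \<in> carrier_vec n. (\<forall>k<n. v $ k \<in> {0, 2}) \<and> real (lee_weight v) < c})
        \<le> (1 + r) ^ n * sqrt r powr (- c)"
      using card_light_vectors_le[of "sqrt r" n "{0, 2}" c] r by simp
    also have "sqrt r powr (- c) = r powr (1 / 2 * - c)"
      unfolding powr_half_sqrt[OF less_imp_le[OF r(1)], symmetric] powr_powr ..
    also have "\<dots> = (r powr (- l)) ^ n"
      using powr_power[of r "- l" n] r by (simp add: c_def mult_ac)
    also have "(1 + r) ^ n * \<dots> = B ^ n"
      unfolding B_def power_mult_distrib ..
    finally have 2: "real (card {v \<in> carrier_vec n. (\<forall>k<n. v $ k \<in> {0, 2}) \<and> real (lee_weight v) < c})
        \<le> B ^ n" .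
    have expo: "n = 8 * k + 8" "2 * (m - 1) = 8 * k + 4" "n = 2 * (4 * k + 4)"
      by (simp_all add: n_def m_def)
    have B2: "B\<^sup>2 = 2 * \<beta>" by (simp add: \<beta>_def)
    have "B ^ (2 * n) = (B\<^sup>2) ^ n" by (rule power_mult)
    also have "\<dots> = (2 * \<beta>) ^ (8 * k + 8)" unfolding B2 expo(1) ..
    also have "\<dots> = 16 * \<beta> ^ (8 * k + 8) * 2 ^ (8 * k + 4)"
      by (simp add: power_mult_distrib power_add)
    also have "(2 :: real) ^ (8 * k + 4) = 2 ^ (2 * (m - 1))" unfolding expo(2) ..
    also have "\<dots> = 4 ^ (m - 1)" by (subst power_mult) simp
    finally have b1: "B ^ (2 * n) / 4 ^ (m - 1) = 16 * \<beta> ^ (8 * k + 8)" by simp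
    have "B ^ n = B ^ (2 * (4 * k + 4))" unfolding expo(3) ..
    also have "\<dots> = (2 * \<beta>) ^ (4 * k + 4)" unfolding power_mult[of B 2] B2 ..
    also have "\<dots> = 4 * \<beta> ^ (4 * k + 4) * 2 ^ (m - 1)"
      by (simp add: power_mult_distrib power_add m_def)
    finally have b2: "B ^ n / 2 ^ (m - 1) = 4 * \<beta> ^ (4 * k + 4)" by simp
    have "real (card {v \<in> carrier_vec n. real (lee_weight v) < c}) / 4 ^ (m - 1)
      + real (card {v \<in> carrier_vec n. (\<forall>k<n. v $ k \<in> {0, 2}) \<and> real (lee_weight v) < c}) / 2 ^ (m - 1)
      \<le> B ^ (2 * n) / 4 ^ (m - 1) + B ^ n / 2 ^ (m - 1)"
      using 1 2 by (intro add_mono divide_right_mono) simp_all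
    also have "\<dots> = 16 * \<beta> ^ (8 * k + 8) + 4 * \<beta> ^ (4 * k + 4)" by (simp only: b1 b2)
    also have "\<dots> \<le> 16 * \<beta> ^ k + 4 * \<beta> ^ k"
      using \<beta> by (intro add_mono mult_left_mono power_decreasing) auto
    also have "\<dots> < 1" using elim by simp
    finally have small: "real (card {v \<in> carrier_vec n. real (lee_weight v) < c}) / 4 ^ (m - 1)
      + real (card {v \<in> carrier_vec n. (\<forall>k<n. v $ k \<in> {0, 2}) \<and> real (lee_weight v) < c}) / 2 ^ (m - 1)
      < 1" .
    have "l * (2 * real n) \<le> 1 / 2 * (2 * real n)" using l d by (intro mult_right_mono) auto
    then have "c \<le> real n" by (simp add: c_def)
    then obtain a where "\<forall>v\<in>code a. v \<noteq> 0\<^sub>v n \<longrightarrow> c \<le> real (lee_weight v)"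
      using ex_code_without_light_words small by blast
    then have "c \<le> real (min_lee_weight n (code a))" by (rule min_lee_weight_code_ge)
    then show ?case using type_II_code[of a] unfolding c_def n_def by blast
  qed
qed

theorem theorem40:
  fixes \<delta> :: real
  assumes "0 < \<delta>" and "\<delta> < 1 / 2"
    and "- \<delta> * log 2 \<delta> - (1 - \<delta>) * log 2 (1 - \<delta>) = 1 / 2"
  shows "\<exists>(n :: nat \<Rightarrow> nat) (C :: nat \<Rightarrow> z4 vec set).
    (\<forall>i. type_II_code (n i) (C i)) \<and>
    filterlim n at_top sequentially \<and>
    ereal \<delta> \<le> liminf (\<lambda>i. ereal (real (min_lee_weight (n i) (C i)) / (2 * real (n i))))"
proof -
  define n where "n k = 8 * (k + 1)" for k :: nat
  \<comment> \<open>Choosing a best code for each length makes one sequence work for all \<open>l < \<delta>\<close>.\<close>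
  have "\<exists>C. type_II_code (n k) C \<and>
      (\<forall>C'. type_II_code (n k) C' \<longrightarrow> min_lee_weight (n k) C' \<le> min_lee_weight (n k) C)" for k
  proof -
    let ?X = "{C. type_II_code (n k) C}"
    obtain e f u where "hyperbolic_frame (n k) (4 * k + 3) e f u"
      using hyperbolic_frame_exists unfolding n_def by blast
    then have ne: "?X \<noteq> {}" using hyperbolic_frame.type_II_code by blast
    have "?X \<subseteq> Pow (carrier_vec (n k))"
      unfolding type_II_code_def self_dual_code_def dual_code_def by blast
    then have fin: "finite ?X" by (rule finite_subset) (simp add: finite_carrier_vec)
    then have "Max (min_lee_weight (n k) ` ?X) \<in> min_lee_weight (n k) ` ?X"
      using ne by (intro Max_in) auto
    then obtain C where "C \<in> ?X" "Max (min_lee_weight (n k) ` ?X) = min_lee_weight (n k) C" by auto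
    moreover have "min_lee_weight (n k) C' \<le> Max (min_lee_weight (n k) ` ?X)" if "C' \<in> ?X" for C'
      using fin that by (intro Max_ge) simp_all
    ultimately show ?thesis by auto
  qed
  then obtain C where C: "\<And>k. type_II_code (n k) (C k)"
    and best: "\<And>k C'. type_II_code (n k) C' \<Longrightarrow> min_lee_weight (n k) C' \<le> min_lee_weight (n k) (C k)"
    by metis
  have "filterlim n at_top sequentially"
    by (rule filterlim_at_top_mono[OF filterlim_ident]) (simp add: n_def)
  moreover have "ereal \<delta> \<le> liminf (\<lambda>k. ereal (real (min_lee_weight (n k) (C k)) / (2 * real (n k))))"
    unfolding le_Liminf_iff
  proof (intro allI impI)
    fix y assume "y < ereal \<delta>"
    \<comment> \<open>\<open>y\<close> may be negative or minus infinity; the maximum ensures a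
      nonnegative real \<open>l\<close>.\<close>
    then have "max y 0 < ereal \<delta>" using assms(1) by simp
    then obtain l where l: "max y 0 < ereal l" "ereal l < ereal \<delta>" using ereal_dense2 by blast
    then have "0 \<le> l" "l < \<delta>" by simp_all
    from eventually_ex_type_II_code[OF assms this]
    show "\<forall>\<^sub>F k in sequentially. y < ereal (real (min_lee_weight (n k) (C k)) / (2 * real (n k)))"
    proof eventually_elim
      case (elim k)
      then obtain C' where C': "type_II_code (n k) C'" "l * (2 * real (n k)) \<le> real (min_lee_weight (n k) C')"
        unfolding n_def by blast
      then have "l * (2 * real (n k)) \<le> real (min_lee_weight (n k) (C k))"
        using best[OF C'(1)] by linarith
      then have "l \<le> real (min_lee_weight (n k) (C k)) / (2 * real (n k))"
        by (simp add: n_def field_simps)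
      then have "ereal l \<le> ereal (real (min_lee_weight (n k) (C k)) / (2 * real (n k)))" by simp
      moreover have "y < ereal l" using l(1) by simp
      ultimately show ?case by (rule order.strict_trans2[rotated])
    qed
  qed
  ultimately show ?thesis using C by blast
qed

end
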